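(* For every integer $n\ge 4$, $\mathrm{gp}_{\mathrm g}(K(n,2)) = \mathrm{gp}_{\mathrm g}'(K(n,2)) = 6$.
   Context: All graphs are finite, simple and undirected. The Kneser graph $K(n,2)$ has as vertices the two-element subsets of $\{1,\dots,n\}$, two of them being adjacent if and only if they are disjoint. A set $S\subseteq V(G)$ is in general position if no shortest path of $G$ contains more than two vertices of $S$. In the Builder-Blocker general position game on a graph $G$, two players, Builder and Blocker, alternately choose (mark) an unmarked vertex of $G$ so that at each stage the set of all marked vertices is in general position; the game ends when no further vertex can be selected. Builder aims to make the final set of marked vertices as large as possible, Blocker as small as possible. In the B-game Builder moves first; in the B'-game Blocker moves first. $\mathrm{gp}_{\mathrm g}(G)$ (respectively $\mathrm{gp}_{\mathrm g}'(G)$) is the number of vertices in the final set when the B-game (respectively B'-game) is played optimally by both players. *)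

theory Defs
  imports "Graph_Theory.Pair_Digraph" "Graph_Theory.Vertex_Walk"
begin

text \<open>
  A finite simple undirected graph is an instance of the locale \<^locale>\<open>pair_graph\<close>:
  finite, loop-free, and with a symmetric set of arcs.
\<close>

section \<open>Kneser graphs\<close>

definition kneser_graph :: "nat \<Rightarrow> nat \<Rightarrow> nat set pair_pre_digraph" where
  "kneser_graph n k = \<lparr>
     pverts = {A. A \<subseteq> {1..n} \<and> card A = k},
     parcs = {(A, B). A \<subseteq> {1..n} \<and> card A = k \<and> B \<subseteq> {1..n} \<and> card B = k \<and> A \<inter> B = {}} \<rparr>"

text \<open>The case \<open>k = 0\<close> is excluded because the empty set is disjoint from itself.\<close>

lemma pair_graph_kneser_graph:
  assumes "k > 0"
  shows "pair_graph (kneser_graph n k)"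
proof
  have fin: "finite {A. A \<subseteq> {1..n} \<and> card A = k}"
    by (rule finite_subset[of _ "Pow {1..n}"]) auto
  then show "finite (pverts (kneser_graph n k))"
    by (simp add: kneser_graph_def)
  have "parcs (kneser_graph n k) \<subseteq>
      {A. A \<subseteq> {1..n} \<and> card A = k} \<times> {A. A \<subseteq> {1..n} \<and> card A = k}"
    unfolding kneser_graph_def by (simp add: subset_iff)
  then show "finite (parcs (kneser_graph n k))"
    by (rule finite_subset) (rule finite_cartesian_product[OF fin fin])
  show "symmetric (with_proj (kneser_graph n k))"
    unfolding symmetric_def with_proj_simps
    by (rule symI) (simp add: kneser_graph_def Int_commute)
next
  fix e assume e: "e \<in> parcs (kneser_graph n k)"
  obtain A B where AB: "e = (A, B)" by (cases e)
  show "fst e \<in> pverts (kneser_graph n k)" "snd e \<in> pverts (kneser_graph n k)"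
    using e AB by (simp_all add: kneser_graph_def)
  show "fst e \<noteq> snd e"
    using e AB assms by (simp add: kneser_graph_def) (metis Int_absorb card.empty neq0_conv)
qed

section \<open>General position\<close>

definition shortest_path :: "'a pair_pre_digraph \<Rightarrow> 'a list \<Rightarrow> bool" where
  "shortest_path G p \<longleftrightarrow>
     vpath p (with_proj G) \<and>
     (\<forall>q. vpath q (with_proj G) \<and> hd q = hd p \<and> last q = last p \<longrightarrow>
          vwalk_length p \<le> vwalk_length q)"

definition general_position :: "'a pair_pre_digraph \<Rightarrow> 'a set \<Rightarrow> bool" where
  "general_position G S \<longleftrightarrow>
     S \<subseteq> pverts G \<and> (\<forall>p. shortest_path G p \<longrightarrow> card (set p \<inter> S) \<le> 2)"

section \<open>The Builder-Blocker general position game\<close>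

datatype player = Builder | Blocker

fun opponent :: "player \<Rightarrow> player" where
  "opponent Builder = Blocker"
| "opponent Blocker = Builder"

definition legal_moves :: "'a pair_pre_digraph \<Rightarrow> 'a set \<Rightarrow> 'a set" where
  "legal_moves G S = {v \<in> pverts G - S. general_position G (insert v S)}"

lemma card_unmarked_decreases:
  assumes "finite (pverts G)" "v \<in> legal_moves G S"
  shows "card (pverts G - insert v S) < card (pverts G - S)"
proof (rule psubset_card_mono)
  show "finite (pverts G - S)"
    using assms(1) by simp
  show "pverts G - insert v S \<subset> pverts G - S"
    using assms(2) by (auto simp: legal_moves_def)
qed

text \<open>
  \<open>game_value G P S\<close> is the number of marked vertices at the end of the game under optimal
  play, when \<open>S\<close> is the set of vertices marked so far and \<open>P\<close> is the player to move.
  On an infinite graph the recursion need not terminate; the value there is a dummy.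
\<close>

function game_value :: "'a pair_pre_digraph \<Rightarrow> player \<Rightarrow> 'a set \<Rightarrow> nat" where
  "game_value G P S =
     (if infinite (pverts G) \<or> legal_moves G S = {} then card S
      else (case P of
              Builder \<Rightarrow> Max ((\<lambda>v. game_value G (opponent P) (insert v S)) ` legal_moves G S)
            | Blocker \<Rightarrow> Min ((\<lambda>v. game_value G (opponent P) (insert v S)) ` legal_moves G S)))"
  by pat_completeness auto
termination
  by (relation "measure (\<lambda>(G, P, S). card (pverts G - S))")
    (simp_all add: card_unmarked_decreases)

declare game_value.simps [simp del]

definition gp_g :: "'a pair_pre_digraph \<Rightarrow> nat" where
  "gp_g G = game_value G Builder {}"

definition gp_g' :: "'a pair_pre_digraph \<Rightarrow> nat" where
  "gp_g' G = game_value G Blocker {}"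

end

theory Submission
  imports Defs
begin

text \<open>
  Read the vertices of the Kneser graph as the edges of the complete graph on \<open>{1..n}\<close>, so that
  adjacency means disjointness. Shortest paths have at most three vertices, and those with three
  are \<open>e, f, g\<close> with \<open>e \<noteq> g\<close> meeting and \<open>f\<close> disjoint from both. Hence a set of edges is in general
  position iff none of its members misses two distinct members that meet each other
  (\<open>kneser_general_position_iff\<close>). Every such set is contained in a star, a matching, or the edge
  set of a \<open>K\<^sub>4\<close>. The last kind is the source of the number 6.

  Three edges that form a path (\<open>path_settled\<close>) or a triangle (\<open>triangle_settled\<close>) fit into no star
  and no matching, so every maximal set containing them is the full edge set of a \<open>K\<^sub>4\<close>: once such a
  configuration is marked, the outcome is 6 whatever the players do. Now any two edges can be
  extended by a single edge to a triangle (if they meet) or a path (if they do not), by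
  \<open>two_pairs_settled_by_move\<close>. So whoever moves at a position with two marked edges can enforce 6.
  If moreover these two edges meet, then the third edge, whoever selects it, gives a path,
  a triangle or a star with three edges, and the star can be completed to a path in one move.
  So with two meeting edges marked the value is 6 for either player to move
  (\<open>meeting_pair_value\<close>).

  In the B-game, Builder enforces 6 since he moves when two edges are marked, and Blocker
  enforces 6 by answering the first edge with an edge meeting it. In the B'-game the two
  arguments are exchanged.
\<close>

section \<open>Settled positions of the game\<close>

lemma game_value_Builder_ge:
  assumes "finite (pverts G)" "v \<in> legal_moves G S"
  shows "game_value G Blocker (insert v S) \<le> game_value G Builder S"
proof -
  have fin: "finite (legal_moves G S)"
    using assms(1) by (simp add: legal_moves_def)
  have "game_value G Builder S = Max ((\<lambda>v. game_value G Blocker (insert v S)) ` legal_moves G S)"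
    using assms by (subst game_value.simps) auto
  then show ?thesis
    using assms(2) fin by simp
qed

lemma game_value_Blocker_le:
  assumes "finite (pverts G)" "v \<in> legal_moves G S"
  shows "game_value G Blocker S \<le> game_value G Builder (insert v S)"
proof -
  have fin: "finite (legal_moves G S)"
    using assms(1) by (simp add: legal_moves_def)
  have "game_value G Blocker S = Min ((\<lambda>v. game_value G Builder (insert v S)) ` legal_moves G S)"
    using assms by (subst game_value.simps) auto
  then show ?thesis
    using assms(2) fin by simp
qed

lemma game_value_Builder_le:
  assumes "finite (pverts G)" "legal_moves G S \<noteq> {}"
    and "\<And>v. v \<in> legal_moves G S \<Longrightarrow> game_value G Blocker (insert v S) \<le> m"
  shows "game_value G Builder S \<le> m"
proof -
  have "finite (legal_moves G S)"
    using assms(1) by (simp add: legal_moves_def)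
  then show ?thesis
    using assms by (subst game_value.simps) auto
qed

lemma game_value_Blocker_ge:
  assumes "finite (pverts G)" "legal_moves G S \<noteq> {}"
    and "\<And>v. v \<in> legal_moves G S \<Longrightarrow> m \<le> game_value G Builder (insert v S)"
  shows "m \<le> game_value G Blocker S"
proof -
  have "finite (legal_moves G S)"
    using assms(1) by (simp add: legal_moves_def)
  then show ?thesis
    using assms by (subst game_value.simps) auto
qed

definition settled :: "'a pair_pre_digraph \<Rightarrow> nat \<Rightarrow> 'a set \<Rightarrow> bool" where
  "settled G m S \<longleftrightarrow> general_position G S \<and>
     (\<forall>T. S \<subseteq> T \<and> general_position G T \<and> legal_moves G T = {} \<longrightarrow> card T = m)"

text \<open>
  Every play ends in a maximal set in general position, and all those reachable from a settled
  position have the same size.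
\<close>

lemma settled_game_value:
  assumes "finite (pverts G)" "settled G m S"
  shows "game_value G P S = m"
  using assms(2)
proof (induction "card (pverts G - S)" arbitrary: P S rule: less_induct)
  case less
  show ?case
  proof (cases "legal_moves G S = {}")
    case True
    then have "game_value G P S = card S"
      by (subst game_value.simps) simp
    then show ?thesis
      using less.prems True by (auto simp: settled_def)
  next
    case False
    have after: "game_value G Q (insert v S) = m" if "v \<in> legal_moves G S" for Q v
    proof (rule less.hyps)
      show "card (pverts G - insert v S) < card (pverts G - S)"
        using assms(1) that by (rule card_unmarked_decreases)
      show "settled G m (insert v S)"
        using less.prems that by (auto simp: settled_def legal_moves_def)
    qed
    have "(\<lambda>v. game_value G Q (insert v S)) ` legal_moves G S = {m}" for Q
      using False after by auto
    then show ?thesis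
      using assms(1) False by (subst game_value.simps) (auto split: player.split)
  qed
qed

definition nearly_settled :: "'a pair_pre_digraph \<Rightarrow> nat \<Rightarrow> 'a set \<Rightarrow> bool" where
  "nearly_settled G m S \<longleftrightarrow>
     settled G m S \<or> (\<exists>v \<in> legal_moves G S. settled G m (insert v S))"

lemma nearly_settled_game_value:
  assumes "finite (pverts G)" "nearly_settled G m S"
  shows "m \<le> game_value G Builder S" "game_value G Blocker S \<le> m"
proof -
  have "m \<le> game_value G Builder S \<and> game_value G Blocker S \<le> m"
  proof (cases "settled G m S")
    case True
    then show ?thesis
      using settled_game_value[OF assms(1)] by simp
  next
    case False
    then obtain v where "v \<in> legal_moves G S" "settled G m (insert v S)"
      using assms(2) by (auto simp: nearly_settled_def)
    then show ?thesis
      using game_value_Builder_ge[OF assms(1)] game_value_Blocker_le[OF assms(1)]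
        settled_game_value[OF assms(1)] by metis
  qed
  then show "m \<le> game_value G Builder S" "game_value G Blocker S \<le> m"
    by auto
qed

text \<open>
  The player to move obtains \<open>m\<close> by settling the position. He cannot do better, since whatever he
  marks, the position is then settled or the opponent can settle it.
\<close>

lemma nearly_settled_twice_game_value:
  assumes "finite (pverts G)" "nearly_settled G m S" "legal_moves G S \<noteq> {}"
    and "\<And>v. v \<in> legal_moves G S \<Longrightarrow> nearly_settled G m (insert v S)"
  shows "game_value G P S = m"
proof (cases P)
  case Builder
  then show ?thesis
    using nearly_settled_game_value[OF assms(1)] assms(2,4)
      game_value_Builder_le[OF assms(1,3)] by (metis le_antisym)
next
  case Blocker
  then show ?thesis
    using nearly_settled_game_value[OF assms(1)] assms(2,4)
      game_value_Blocker_ge[OF assms(1,3)] by (metis le_antisym)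
qed

section \<open>General position in Kneser graphs of pairs\<close>

lemma pverts_kneser [simp]: "A \<in> pverts (kneser_graph n k) \<longleftrightarrow> A \<subseteq> {1..n} \<and> card A = k"
  by (simp add: kneser_graph_def)

lemma parcs_kneser [simp]:
  "(A, B) \<in> parcs (kneser_graph n k) \<longleftrightarrow>
     A \<in> pverts (kneser_graph n k) \<and> B \<in> pverts (kneser_graph n k) \<and> A \<inter> B = {}"
  by (auto simp: kneser_graph_def)

lemma finite_pverts_kneser: "finite (pverts (kneser_graph n k))"
  by (simp add: kneser_graph_def)

lemma doubleton_meets_iff [simp]: "{a, b} \<inter> A = {} \<longleftrightarrow> a \<notin> A \<and> b \<notin> A"
  by auto

text \<open>
  A path that leaves \<open>x\<close> through \<open>y\<close> and passes on to \<open>z \<noteq> x\<close> uses up five points of \<open>{1..n}\<close>.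
  So there is room for a common neighbour of any two vertices that meet, and
  a shortest path has no more than three vertices.
\<close>

lemma kneser_shortest_path_length:
  assumes "shortest_path (kneser_graph n 2) p"
  shows "length p \<le> 3"
proof (rule ccontr)
  let ?G = "kneser_graph n 2"
  assume "\<not> length p \<le> 3"
  then obtain x y z r where p: "p = x # y # z # r" and r: "r \<noteq> []"
    by (cases p; cases "tl p"; cases "tl (tl p)") auto
  define w where "w = last p"
  have vp: "vpath p (with_proj ?G)"
    and short: "\<And>q. vpath q (with_proj ?G) \<Longrightarrow> hd q = x \<Longrightarrow> last q = w \<Longrightarrow> length p \<le> length q"
    using assms p r by (auto simp: shortest_path_def w_def)
  have xyz: "x \<in> pverts ?G" "y \<in> pverts ?G" "z \<in> pverts ?G" "x \<inter> y = {}" "y \<inter> z = {}" "x \<noteq> z"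
    using vp p by (auto simp: vpath_def vwalk_def)
  have "w \<in> set r"
    using p r by (simp add: w_def)
  then have w: "w \<in> pverts ?G" "x \<noteq> w"
    using vp p by (auto simp: vpath_def vwalk_def simp del: pverts_kneser parcs_kneser)
  have fin: "finite x" "finite y" "finite z" "finite w"
    using xyz w by (simp_all add: card_ge_0_finite)
  have "x \<inter> w \<noteq> {}"
    using short[of "[x, w]"] p xyz w by (auto simp: vpath_def vwalk_def)
  then have "0 < card (x \<inter> w)"
    using fin by (simp add: card_gt_0_iff)
  moreover have "card (x \<union> w) + card (x \<inter> w) = 4"
    using card_Un_Int[of x w] xyz w fin by simp
  ultimately have "card (x \<union> w) \<le> 3"
    by linarith
  have "\<not> z \<subseteq> x"
    using xyz fin card_subset_eq[of x z] by auto
  then obtain t where t: "t \<in> z" "t \<notin> x" by blast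
  have "5 \<le> card (insert t (x \<union> y))"
    using t xyz fin by (subst card_insert_disjoint) (auto simp: card_Un_disjoint)
  also have "\<dots> \<le> card {1..n}"
    using t xyz by (intro card_mono) auto
  finally have "2 \<le> card ({1..n} - (x \<union> w))"
    using \<open>card (x \<union> w) \<le> 3\<close> xyz w fin by (simp add: card_Diff_subset)
  then obtain f where f: "f \<subseteq> {1..n} - (x \<union> w)" "card f = 2"
    by (meson obtain_subset_with_card_n)
  have fV: "f \<in> pverts ?G" and disj: "x \<inter> f = {}" "f \<inter> w = {}"
    using f by auto
  have "x \<noteq> f" "f \<noteq> w"
    using disj f(2) by auto
  with fV disj xyz(1) w have "vpath [x, f, w] (with_proj ?G)"
    by (simp add: vpath_def vwalk_def)
  from short[OF this] show False
    using p r by (cases r) auto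
qed

theorem kneser_general_position_iff:
  "general_position (kneser_graph n 2) S \<longleftrightarrow>
     S \<subseteq> pverts (kneser_graph n 2) \<and>
     (\<forall>e \<in> S. \<forall>f \<in> S. \<forall>g \<in> S. e \<noteq> g \<and> e \<inter> g \<noteq> {} \<longrightarrow> e \<inter> f \<noteq> {} \<or> g \<inter> f \<noteq> {})"
    (is "?L \<longleftrightarrow> ?R")
proof
  let ?G = "kneser_graph n 2"
  assume L: ?L
  have "e \<inter> f \<noteq> {} \<or> g \<inter> f \<noteq> {}"
    if S: "e \<in> S" "f \<in> S" "g \<in> S" and eg: "e \<noteq> g" "e \<inter> g \<noteq> {}" for e f g
  proof (rule ccontr)
    assume "\<not> ?thesis"
    then have f: "e \<inter> f = {}" "g \<inter> f = {}" by auto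
    have V: "e \<in> pverts ?G" "f \<in> pverts ?G" "g \<in> pverts ?G"
      using L S by (auto simp: general_position_def simp del: pverts_kneser)
    have ne: "e \<noteq> f" "g \<noteq> f"
      using V f by auto
    have path: "vpath [e, f, g] (with_proj ?G)"
      using V f eg ne by (auto simp: vpath_def vwalk_def)
    have "2 \<le> vwalk_length q" if q: "vpath q (with_proj ?G)" "hd q = e" "last q = g" for q
    proof (rule ccontr)
      assume "\<not> 2 \<le> vwalk_length q"
      with q have "q = [e] \<or> q = [e, g]"
        by (cases q; cases "tl q"; cases "tl (tl q)") (auto simp: vpath_def vwalk_def)
      then show False
        using q eg by (elim disjE) (simp_all add: vpath_def vwalk_def)
    qed
    then have "shortest_path ?G [e, f, g]"
      using path by (simp add: shortest_path_def numeral_2_eq_2)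
    then have "card (set [e, f, g] \<inter> S) \<le> 2"
      using L unfolding general_position_def by blast
    moreover have "set [e, f, g] \<inter> S = {e, f, g}"
      using S by auto
    ultimately show False
      using eg ne by auto
  qed
  then show ?R
    using L by (auto simp: general_position_def simp del: pverts_kneser)
next
  let ?G = "kneser_graph n 2"
  assume R: ?R
  have "card (set p \<inter> S) \<le> 2" if p: "shortest_path ?G p" for p
  proof (rule ccontr)
    assume "\<not> ?thesis"
    then have three: "3 \<le> card (set p \<inter> S)" by simp
    have "card (set p \<inter> S) \<le> card (set p)" "card (set p) \<le> length p"
      by (auto intro: card_mono card_length)
    with three kneser_shortest_path_length[OF p]
    have len: "length p = 3" "card (set p) = 3" "card (set p \<inter> S) = card (set p)"
      by auto
    obtain e f g where efg: "p = [e, f, g]"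
      using len(1) by (auto simp: numeral_eq_Suc length_Suc_conv)
    have "set p \<inter> S = set p"
      using len(3) by (intro card_subset_eq) auto
    then have S: "e \<in> S" "f \<in> S" "g \<in> S"
      using efg by auto
    have vp: "vpath [e, f, g] (with_proj ?G)"
      and short: "\<And>q. vpath q (with_proj ?G) \<Longrightarrow> hd q = e \<Longrightarrow> last q = g \<Longrightarrow> 3 \<le> length q"
      using p efg by (auto simp: shortest_path_def)
    have facts: "e \<noteq> g" "e \<inter> f = {}" "g \<inter> f = {}" "e \<in> pverts ?G" "g \<in> pverts ?G"
      using vp by (auto simp: vpath_def vwalk_def)
    have "e \<inter> g \<noteq> {}"
      using short[of "[e, g]"] facts by (auto simp: vpath_def vwalk_def)
    then show False
      using R S facts by blast
  qed
  then show ?L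
    using R by (simp add: general_position_def)
qed

lemma kneser_general_positionD:
  assumes "general_position (kneser_graph n 2) S" "e \<in> S" "f \<in> S" "g \<in> S" "e \<noteq> g" "e \<inter> g \<noteq> {}"
  shows "e \<inter> f \<noteq> {} \<or> g \<inter> f \<noteq> {}"
  using assms unfolding kneser_general_position_iff by blast

lemma general_position_subset:
  assumes "general_position G T" "S \<subseteq> T"
  shows "general_position G S"
proof -
  have "card (set p \<inter> S) \<le> card (set p \<inter> T)" for p
    using assms(2) by (intro card_mono) auto
  then show ?thesis
    using assms unfolding general_position_def by (meson dual_order.trans)
qed

lemma general_position_two:
  assumes "e \<in> pverts (kneser_graph n 2)" "f \<in> pverts (kneser_graph n 2)"
  shows "general_position (kneser_graph n 2) {e, f}"
  using assms unfolding kneser_general_position_iff by auto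

section \<open>Positions that force the edges of a complete graph on four points\<close>

definition pairs :: "'a set \<Rightarrow> 'a set set" where
  "pairs Q = {e. e \<subseteq> Q \<and> card e = 2}"

lemma card_pairs:
  assumes "card Q = 4"
  shows "card (pairs Q) = 6"
  using n_subsets[of Q 2] assms by (simp add: pairs_def card_ge_0_finite choose_two)

lemma doubleton_in_pairs [simp]: "{a, b} \<in> pairs Q \<longleftrightarrow> a \<in> Q \<and> b \<in> Q \<and> a \<noteq> b"
  by (auto simp: pairs_def card_2_iff)

text \<open>
  Two distinct pairs that meet cover three of the four points, which leaves no room for a pair
  disjoint from both.
\<close>

lemma general_position_pairs:
  assumes "Q \<subseteq> {1..n}" "card Q = 4"
  shows "general_position (kneser_graph n 2) (pairs Q)"
  unfolding kneser_general_position_iff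
proof (intro conjI ballI impI)
  show "pairs Q \<subseteq> pverts (kneser_graph n 2)"
    using assms(1) by (auto simp: pairs_def)
next
  fix e f g assume *: "e \<in> pairs Q" "f \<in> pairs Q" "g \<in> pairs Q" "e \<noteq> g \<and> e \<inter> g \<noteq> {}"
  have finQ: "finite Q" using assms(2) by (simp add: card_ge_0_finite)
  show "e \<inter> f \<noteq> {} \<or> g \<inter> f \<noteq> {}"
  proof (rule ccontr)
    assume "\<not> ?thesis"
    then have disj: "(e \<union> g) \<inter> f = {}" by auto
    have fin: "finite e" "finite f" "finite g"
      using * finQ by (auto simp: pairs_def intro: finite_subset)
    have "\<not> g \<subseteq> e"
      using * fin card_subset_eq[of e g] by (auto simp: pairs_def)
    then have "e \<subset> e \<union> g" by blast
    then have "2 < card (e \<union> g)"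
      using * fin psubset_card_mono[of "e \<union> g" e] by (simp add: pairs_def)
    then have "4 < card (e \<union> g \<union> f)"
      using * fin disj by (simp add: card_Un_disjoint pairs_def)
    moreover have "card (e \<union> g \<union> f) \<le> card Q"
      using * finQ by (intro card_mono) (auto simp: pairs_def)
    ultimately show False using assms(2) by simp
  qed
qed

lemma maximal_within_pairs:
  assumes "Q \<subseteq> {1..n}" "card Q = 4" "T \<subseteq> pairs Q" "legal_moves (kneser_graph n 2) T = {}"
  shows "card T = 6"
proof -
  have "v \<in> T" if "v \<in> pairs Q" for v
  proof (rule ccontr)
    assume "v \<notin> T"
    moreover have "general_position (kneser_graph n 2) (insert v T)"
      using general_position_pairs[OF assms(1,2)] that assms(3)
      by (auto intro: general_position_subset)
    ultimately have "v \<in> legal_moves (kneser_graph n 2) T"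
      using that assms(1) by (auto simp: legal_moves_def pairs_def)
    then show False using assms(4) by simp
  qed
  then have "T = pairs Q" using assms(3) by blast
  then show ?thesis using card_pairs assms(2) by simp
qed

text \<open>
  The disjoint ends \<open>{a, b}\<close> and \<open>{c, d}\<close> of the path do the work: an edge that meets one of them
  without being equal to it must meet the other as well.
\<close>

lemma path_within_pairs:
  assumes T: "general_position (kneser_graph n 2) T" "{a, b} \<in> T" "{b, c} \<in> T" "{c, d} \<in> T"
    and dist: "distinct [a, b, c, d]"
  shows "T \<subseteq> pairs {a, b, c, d}"
proof
  fix h assume h: "h \<in> T"
  then have "card h = 2"
    using T(1) by (auto simp: kneser_general_position_iff)
  then obtain x y where xy: "h = {x, y}" "x \<noteq> y" by (auto simp: card_2_iff)
  note D = kneser_general_positionD[OF T(1)]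
  have near: "h \<inter> {a, b} \<noteq> {} \<or> h \<inter> {c, d} \<noteq> {}"
    using D[OF T(2) h T(3)] dist by (auto simp: doubleton_eq_iff)
  have left: "h \<inter> {c, d} \<noteq> {}" if "h \<inter> {a, b} \<noteq> {}" "h \<noteq> {a, b}"
    using D[OF T(2) T(4) h] that dist by auto
  have right: "h \<inter> {a, b} \<noteq> {}" if "h \<inter> {c, d} \<noteq> {}" "h \<noteq> {c, d}"
    using D[OF T(4) T(2) h] that dist by auto
  show "h \<in> pairs {a, b, c, d}"
  proof (cases "h = {a, b} \<or> h = {c, d}")
    case True
    then show ?thesis using dist by auto
  next
    case False
    then have "h \<inter> {a, b} \<noteq> {}" "h \<inter> {c, d} \<noteq> {}"
      using near left right by blast+
    then show ?thesis using xy dist by auto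
  qed
qed

lemma path_settled:
  assumes S: "general_position (kneser_graph n 2) S" "{a, b} \<in> S" "{b, c} \<in> S" "{c, d} \<in> S"
    and dist: "distinct [a, b, c, d]"
  shows "settled (kneser_graph n 2) 6 S"
proof -
  have Q: "{a, b, c, d} \<subseteq> {1..n}" "card {a, b, c, d} = 4"
    using S dist by (auto simp: kneser_general_position_iff)
  have "card T = 6" if "S \<subseteq> T" "general_position (kneser_graph n 2) T"
    "legal_moves (kneser_graph n 2) T = {}" for T
    using path_within_pairs[OF that(2) _ _ _ dist] that S
    by (intro maximal_within_pairs[OF Q]) auto
  then show ?thesis
    using S(1) by (simp add: settled_def)
qed

text \<open>
  A further edge cannot miss the triangle altogether, so it is attached to one of its vertices and
  forms a path with two of its sides. Since \<open>n \<ge> 4\<close>, the triangle alone is not maximal.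
\<close>

lemma triangle_settled:
  assumes S: "general_position (kneser_graph n 2) S" "{a, b} \<in> S" "{b, c} \<in> S" "{a, c} \<in> S"
    and dist: "distinct [a, b, c]" and n: "n \<ge> 4"
  shows "settled (kneser_graph n 2) 6 S"
  unfolding settled_def
proof (intro conjI allI impI S(1))
  let ?G = "kneser_graph n 2"
  fix T assume "S \<subseteq> T \<and> general_position ?G T \<and> legal_moves ?G T = {}"
  then have T: "general_position ?G T" "{a, b} \<in> T" "{b, c} \<in> T" "{a, c} \<in> T"
    and maximal: "legal_moves ?G T = {}"
    using S by auto
  have abc: "{a, b, c} \<subseteq> {1..n}" "card {a, b, c} = 3"
    using T dist by (auto simp: kneser_general_position_iff)
  have "\<exists>h \<in> T. h \<notin> {{a, b}, {b, c}, {a, c}}"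
  proof (rule ccontr)
    assume "\<not> ?thesis"
    then have T_eq: "T = {{a, b}, {b, c}, {a, c}}"
      using T by auto
    have "card {a, b, c} < card {1..n}"
      using abc(2) n by simp
    then obtain d where d: "d \<in> {1..n}" "d \<notin> {a, b, c}"
      by (metis card_mono finite.emptyI finite.insertI linorder_not_less subsetI)
    have Q: "{a, b, c, d} \<subseteq> {1..n}" "card {a, b, c, d} = 4"
      using abc d dist by auto
    have "T \<subseteq> pairs {a, b, c, d}"
      using T_eq dist by auto
    from maximal_within_pairs[OF Q this maximal] have "6 \<le> card T" by simp
    moreover have "card T \<le> 3"
      using T_eq card_length[of "[{a, b}, {b, c}, {a, c}]"] by simp
    ultimately show False by simp
  qed
  then obtain h where h: "h \<in> T" "h \<notin> {{a, b}, {b, c}, {a, c}}" by blast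
  have "card h = 2"
    using h T(1) by (auto simp: kneser_general_position_iff)
  have "h \<inter> {a, b, c} \<noteq> {}"
    using kneser_general_positionD[OF T(1,2) h(1) T(3)] dist by (auto simp: doubleton_eq_iff)
  then obtain x where x: "x \<in> h" "x \<in> {a, b, c}" by blast
  obtain d where d: "h = {d, x}" "d \<noteq> x"
    using \<open>card h = 2\<close> x(1) by (auto simp: card_2_iff)
  have "d \<notin> {a, b, c}"
    using h(2) d x(2) by (auto simp: insert_commute)
  then have "settled ?G 6 T"
    using x(2) d h(1) T dist
      path_settled[OF T(1), of d a b c] path_settled[OF T(1), of d b c a]
      path_settled[OF T(1), of d c b a]
    by (auto simp: insert_commute)
  then show "card T = 6"
    using T(1) maximal by (auto simp: settled_def)
qed

section \<open>Positions with two marked pairs\<close>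

lemma meeting_pairsE:
  assumes "card e = 2" "card f = 2" "e \<noteq> f" "e \<inter> f \<noteq> {}"
  obtains a b c where "e = {a, b}" "f = {a, c}" "distinct [a, b, c]"
proof -
  obtain a where a: "a \<in> e" "a \<in> f" using assms(4) by blast
  obtain b where b: "e = {a, b}" "b \<noteq> a" using assms(1) a(1) by (auto simp: card_2_iff)
  obtain c where c: "f = {a, c}" "c \<noteq> a" using assms(2) a(2) by (auto simp: card_2_iff)
  show ?thesis using that[of a b c] b c assms(3) by auto
qed

text \<open>The new edge joins two disjoint edges to a path, or closes two meeting edges to a triangle.\<close>

lemma two_pairs_settled_by_move:
  assumes n: "n \<ge> 4" and e: "e \<in> pverts (kneser_graph n 2)" and f: "f \<in> pverts (kneser_graph n 2)"
    and "e \<noteq> f"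
  shows "\<exists>v \<in> legal_moves (kneser_graph n 2) {e, f}. settled (kneser_graph n 2) 6 (insert v {e, f})"
proof -
  let ?G = "kneser_graph n 2"
  have by_settled: ?thesis if "settled ?G 6 (insert v {e, f})" "v \<notin> {e, f}" for v
  proof -
    have "general_position ?G (insert v {e, f})"
      using that(1) unfolding settled_def by blast
    then have "v \<in> legal_moves ?G {e, f}"
      using that(2) unfolding legal_moves_def general_position_def by blast
    then show ?thesis
      using that(1) by blast
  qed
  show ?thesis
  proof (cases "e \<inter> f = {}")
    case True
    obtain a b where ab: "e = {a, b}" "a \<noteq> b" using e by (auto simp: card_2_iff)
    obtain c d where cd: "f = {c, d}" "c \<noteq> d" using f by (auto simp: card_2_iff)
    have dist: "distinct [a, b, c, d]" using ab cd True by auto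
    have "general_position ?G (pairs {a, b, c, d})"
      using ab cd e f dist by (intro general_position_pairs) auto
    then have "general_position ?G {{b, c}, e, f}"
      by (rule general_position_subset) (use ab cd dist in auto)
    from path_settled[OF this, of a b c d] ab cd dist show ?thesis
      by (intro by_settled[of "{b, c}"]) (auto simp: doubleton_eq_iff)
  next
    case False
    then obtain a b c where abc: "e = {a, b}" "f = {a, c}" "distinct [a, b, c]"
      using e f \<open>e \<noteq> f\<close> by (metis meeting_pairsE pverts_kneser)
    have gp: "general_position ?G {{b, c}, e, f}"
      unfolding kneser_general_position_iff using e f abc by auto
    have "settled ?G 6 {{b, c}, e, f}"
      using triangle_settled[OF gp, of a b c] abc n by simp
    then show ?thesis
      by (intro by_settled[of "{b, c}"]) (use abc in \<open>auto simp: doubleton_eq_iff\<close>)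
  qed
qed

text \<open>
  The third edge \<open>g\<close> must meet \<open>{a, b}\<close> or \<open>{a, c}\<close>. If it avoids \<open>a\<close>, it completes a path or a
  triangle. If \<open>g = {a, d}\<close>, the three edges form a star, and marking \<open>{b, c}\<close> creates the path
  \<open>d, a, b, c\<close>; this is the only case in which the next player still has to act.
\<close>

lemma meeting_pair_any_move:
  assumes n: "n \<ge> 4" and e: "e \<in> pverts (kneser_graph n 2)" and f: "f \<in> pverts (kneser_graph n 2)"
    and ef: "e \<noteq> f" "e \<inter> f \<noteq> {}" and g: "g \<in> legal_moves (kneser_graph n 2) {e, f}"
  shows "nearly_settled (kneser_graph n 2) 6 (insert g {e, f})"
proof -
  let ?G = "kneser_graph n 2" and ?S = "insert g {e, f}"
  obtain a b c where abc: "e = {a, b}" "f = {a, c}" "distinct [a, b, c]"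
    using e f ef by (metis meeting_pairsE pverts_kneser)
  have gp: "general_position ?G ?S" and gv: "g \<in> pverts ?G" and new: "g \<noteq> e" "g \<noteq> f"
    using g by (auto simp: legal_moves_def)
  obtain x y where xy: "g = {x, y}" "x \<noteq> y" using gv by (auto simp: card_2_iff)
  have meets: "g \<inter> {a, b, c} \<noteq> {}"
    using kneser_general_positionD[OF gp, of e g f] ef abc by auto
  have S: "{a, b} \<in> ?S" "{b, a} \<in> ?S" "{a, c} \<in> ?S" "{c, a} \<in> ?S" "g \<in> ?S"
    using abc by (auto simp: insert_commute)
  consider (star) d where "g = {d, a}" "d \<notin> {a, b, c}" | (triangle) "g = {b, c}"
    | (path_b) d where "g = {b, d}" "d \<notin> {a, b, c}" | (path_c) d where "g = {c, d}" "d \<notin> {a, b, c}"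
    using xy meets new abc by (auto simp: doubleton_eq_iff)
  then show ?thesis
  proof cases
    case star
    have Q: "{a, b, c, d} \<subseteq> {1..n}" "card {a, b, c, d} = 4"
      using star abc e f gv by auto
    have gp': "general_position ?G (insert {b, c} ?S)"
      using general_position_pairs[OF Q]
      by (rule general_position_subset) (use star abc in auto)
    have "settled ?G 6 (insert {b, c} ?S)"
      using path_settled[OF gp', of d a b c] star S abc by auto
    moreover have "{b, c} \<in> legal_moves ?G ?S"
      using gp' star abc e f by (auto simp: legal_moves_def doubleton_eq_iff)
    ultimately show ?thesis
      by (auto simp: nearly_settled_def)
  next
    case triangle
    then show ?thesis
      using triangle_settled[OF gp, of a b c] S abc n by (simp add: nearly_settled_def)
  next
    case path_b
    then show ?thesis
      using path_settled[OF gp, of c a b d] S abc by (simp add: nearly_settled_def)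
  next
    case path_c
    then show ?thesis
      using path_settled[OF gp, of b a c d] S abc by (simp add: nearly_settled_def)
  qed
qed

lemma meeting_pair_value:
  assumes "n \<ge> 4" "e \<in> pverts (kneser_graph n 2)" "f \<in> pverts (kneser_graph n 2)"
    and "e \<noteq> f" "e \<inter> f \<noteq> {}"
  shows "game_value (kneser_graph n 2) P {e, f} = 6"
proof -
  let ?G = "kneser_graph n 2"
  have ex: "\<exists>v \<in> legal_moves ?G {e, f}. settled ?G 6 (insert v {e, f})"
    using two_pairs_settled_by_move assms(1-4) .
  show ?thesis
  proof (rule nearly_settled_twice_game_value[OF finite_pverts_kneser])
    show "nearly_settled ?G 6 {e, f}" "legal_moves ?G {e, f} \<noteq> {}"
      using ex by (auto simp: nearly_settled_def)
    show "nearly_settled ?G 6 (insert g {e, f})" if "g \<in> legal_moves ?G {e, f}" for g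
      using meeting_pair_any_move assms that .
  qed
qed

section \<open>The value of the game\<close>

theorem theorem2p10:
  fixes n :: nat
  assumes "n \<ge> 4"
  shows "gp_g (kneser_graph n 2) = 6 \<and> gp_g' (kneser_graph n 2) = 6"
proof -
  let ?G = "kneser_graph n 2"
  note fin = finite_pverts_kneser[of n 2]
  have first: "legal_moves ?G {} = pverts ?G"
  proof -
    have "general_position ?G {v}" if "v \<in> pverts ?G" for v
      using general_position_two[OF that that] by simp
    then show ?thesis
      unfolding legal_moves_def by blast
  qed
  have second: "legal_moves ?G {e} = pverts ?G - {e}" if "e \<in> pverts ?G" for e
    using general_position_two[OF _ that] unfolding legal_moves_def by blast
  have start: "{1, 2} \<in> pverts ?G"
    using assms by auto
  have meeting: "\<exists>f. f \<in> pverts ?G \<and> f \<noteq> e \<and> f \<inter> e \<noteq> {}" if e: "e \<in> pverts ?G" for e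
  proof -
    obtain a b where ab: "e = {a, b}" "a \<noteq> b" using e by (auto simp: card_2_iff)
    have "card {a, b} < card {1..n}"
      using assms ab by simp
    then obtain c where c: "c \<in> {1..n}" "c \<notin> {a, b}"
      by (metis card_mono finite.emptyI finite.insertI linorder_not_less subsetI)
    then show ?thesis
      using e ab by (intro exI[of _ "{a, c}"]) (auto simp: doubleton_eq_iff)
  qed
  have moves: "legal_moves ?G {} \<noteq> {}" "\<And>e. e \<in> pverts ?G \<Longrightarrow> legal_moves ?G {e} \<noteq> {}"
    using start meeting by (auto simp: first second simp del: pverts_kneser)
  have mover: "6 \<le> game_value ?G Builder {f, e}" "game_value ?G Blocker {f, e} \<le> 6"
    if "e \<in> pverts ?G" "f \<in> legal_moves ?G {e}" for e f
    using nearly_settled_game_value[OF fin, of 6 "{f, e}"] two_pairs_settled_by_move[OF assms, of f e]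
      that second[OF that(1)] by (auto simp: nearly_settled_def simp del: pverts_kneser)
  \<comment> \<open>With one marked pair, the player to move reaches 6 by marking a pair that meets it, and the
    opponent, who moves when two pairs are marked, can hold the value at 6.\<close>
  have one: "game_value ?G P {e} = 6" if e: "e \<in> pverts ?G" for e P
  proof -
    obtain f where f: "f \<in> legal_moves ?G {e}" "game_value ?G (opponent P) {f, e} = 6"
      using meeting[OF e] meeting_pair_value[OF assms] e second[OF e] by blast
    show ?thesis
    proof (cases P)
      case Builder
      have "game_value ?G Builder {e} \<le> 6"
        using mover(2)[OF e] by (intro game_value_Builder_le fin moves(2) e)
      moreover have "6 \<le> game_value ?G Builder {e}"
        using game_value_Builder_ge[OF fin f(1)] f(2) Builder by simp
      ultimately show ?thesis using Builder by simp
    next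
      case Blocker
      have "6 \<le> game_value ?G Blocker {e}"
        using mover(1)[OF e] by (intro game_value_Blocker_ge fin moves(2) e)
      moreover have "game_value ?G Blocker {e} \<le> 6"
        using game_value_Blocker_le[OF fin f(1)] f(2) Blocker by simp
      ultimately show ?thesis using Blocker by simp
    qed
  qed
  have "game_value ?G Builder {} = 6" "game_value ?G Blocker {} = 6"
    using one start moves(1) first game_value_Builder_ge[OF fin, of "{1, 2}" "{}"]
      game_value_Blocker_le[OF fin, of "{1, 2}" "{}"]
      game_value_Builder_le[OF fin, of "{}" 6] game_value_Blocker_ge[OF fin, of "{}" 6]
    by (metis le_antisym order_refl)+
  then show ?thesis
    by (simp add: gp_g_def gp_g'_def)
qed

end
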